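(* Let $k_G^{\mathbb{C}} := 4/\pi$. Let $X \in M_{(m,n)}(\mathbb{C})$ with $\|X\|_c \leq 1$ and let $0 < \varepsilon < 1$. Then there exist a natural number $\hat l$, a matrix $\hat C \in M_{(m,\hat l)}(\mathbb{C})$ with $\|\hat C\|_\infty < \sqrt{k_G^{\mathbb{C}}}\,(1+\varepsilon)$, and a matrix $\hat Z \in M_{(\hat l, n)}(\mathbb{T})$ such that $$X = (\hat l)^{-1/2}\, \hat C \hat Z.$$
   Context: $M_{(m,n)}(\mathbb{C})$ denotes the complex $m\times n$ matrices; $\mathbb{T}$ is the unit circle in $\mathbb{C}$ and $M_{(l,n)}(\mathbb{T})$ is the set of $l\times n$ matrices with all entries in $\mathbb{T}$. $\|C\|_\infty$ is the operator norm of $C$ (with respect to Euclidean norms). The column norm of $X$ is $\|X\|_c := \max_j \|X_j\|_2$, where $X_j$ is the $j$-th column of $X$. *)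

theory Defs
  imports "HOL-Analysis.L2_Norm" "Jordan_Normal_Form.Matrix"
begin

definition kGC :: real where
  "kGC = 4 / pi"

definition euclid_norm :: "complex vec \<Rightarrow> real" where
  "euclid_norm v = L2_set (\<lambda>i. cmod (v $ i)) {..<dim_vec v}"

(* Only meaningful for matrices with at least one column. *)
definition column_norm :: "complex mat \<Rightarrow> real" where
  "column_norm X = Max ((\<lambda>j. euclid_norm (col X j)) ` {..<dim_col X})"

(* The set is nonempty and, the dimensions being finite, bounded above,
   so this real supremum is a genuine one. *)
definition op_norm :: "complex mat \<Rightarrow> real" where
  "op_norm C = Sup {euclid_norm (C *\<^sub>v v) | v. v \<in> carrier_vec (dim_col C) \<and> euclid_norm v \<le> 1}"

definition unimodular_mat :: "nat \<Rightarrow> nat \<Rightarrow> complex mat set" where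
  "unimodular_mat l n = {Z \<in> carrier_mat l n. \<forall>i<l. \<forall>j<n. cmod (Z $$ (i, j)) = 1}"

end

theory Submission
  imports "HOL-Probability.Distributions" Defs
begin

text \<open>
Padding the columns with one extra coordinate makes them unit vectors \<open>x\<close> in complex
\<open>d\<close>-space, \<open>d = m + 1\<close>. Let \<open>g\<close> be a complex Gaussian vector whose real and imaginary parts are
independent standard normals, and let \<open>Z\<close> be the conjugate phase of \<open>\<langle>x, g\<rangle> = (\<Sum>i. cnj (x i) * g i)\<close>
(the variable \<open>h x\<close> below), a unimodular random variable. Then
\<open>E (Z g) = sqrt (pi / 2) x\<close> and \<open>E (g g*) = 2 I\<close>,
so that \<open>x\<close> is the image of \<open>Z\<close> under the operator \<open>f \<mapsto> E (f sqrt (2 / pi) g)\<close> from \<open>L^2\<close>, which does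
not depend on \<open>x\<close> and has squared norm \<open>2 / pi * 2 = 4 / pi\<close>. This is the required factorization,
with a probability space in place of \<open>l\<close> equally weighted points, and without any loss.

The first moment identity follows from the scalar identity \<open>E |\<langle>x, g\<rangle>| = sqrt (pi / 2) |x|\<close> (\<open>expectation_norm_h\<close>) because \<open>E (Z g)\<close>
is a subgradient at \<open>x\<close> of the left-hand side, as a function of \<open>x\<close>, while the right-hand side is
differentiable there (\<open>expectation_phase_conj_h\<close>). The scalar identity in turn reduces to the first
absolute moment of a real normal variable, because the modulus of a complex number is half the
integral over \<open>{0..pi}\<close> of the moduli of the real parts of its rotations.

Finitely many sample points reproduce the finitely many moments involved, up to a small error
(\<open>simultaneous_sampling\<close>). The remaining error in \<open>X\<close> is removed exactly
(\<open>exact_factorization_from_samples\<close>): a number in the disc of radius \<open>\<delta>\<close> is the midpoint of two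
numbers of modulus \<open>\<delta>\<close>, so additional columns of \<open>C\<close>, small multiples of unit coordinate vectors,
can produce any error matrix with entries bounded by \<open>\<delta>\<close>. Weighting the samples against these
columns costs only a factor \<open>1 + \<epsilon>\<close> in the norm.
\<close>

section \<open>Reproducing expectations by equally weighted points\<close>

lemma (in prob_space) exists_le_expectation:
  fixes h :: "'a \<Rightarrow> real"
  assumes "integrable M h"
  shows "\<exists>\<omega>\<in>space M. h \<omega> \<le> expectation h"
proof (rule ccontr)
  assume "\<not> ?thesis"
  then have "AE \<omega> in M. expectation h < h \<omega>"
    by (intro AE_I2) (auto simp: not_le)
  from expectation_greater[OF assms this] show False by simp
qed

text \<open>The points are chosen one at a time. If \<open>S\<close> is the current vector of partial sums, the expected value
of \<open>|S + f|^2\<close> is \<open>|S|^2\<close> plus the total variance, because the mixed term vanishes; so some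
point increases \<open>|S|^2\<close> by at most the variance. The bound is the mean square of independent
samples.\<close>

lemma (in prob_space) greedy_sampling:
  fixes f :: "'i \<Rightarrow> 'a \<Rightarrow> 'b::{real_inner,banach,second_countable_topology}"
  assumes "finite I"
    and int: "\<And>i. i \<in> I \<Longrightarrow> integrable M (f i)"
    and int2: "\<And>i. i \<in> I \<Longrightarrow> integrable M (\<lambda>\<omega>. (norm (f i \<omega>))\<^sup>2)"
    and mean: "\<And>i. i \<in> I \<Longrightarrow> expectation (f i) = 0"
  shows "\<exists>\<omega> :: nat \<Rightarrow> 'a. \<forall>l. (\<Sum>i\<in>I. (norm (\<Sum>k<l. f i (\<omega> k)))\<^sup>2)
           \<le> real l * (\<Sum>i\<in>I. expectation (\<lambda>\<omega>. (norm (f i \<omega>))\<^sup>2))"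
proof -
  define V where "V = (\<Sum>i\<in>I. expectation (\<lambda>\<omega>. (norm (f i \<omega>))\<^sup>2))"
  have step: "\<exists>w. (\<Sum>i\<in>I. (norm (S i + f i w))\<^sup>2) \<le> (\<Sum>i\<in>I. (norm (S i))\<^sup>2) + V" for S :: "'i \<Rightarrow> 'b"
  proof -
    define h where "h = (\<lambda>w. \<Sum>i\<in>I. (norm (S i))\<^sup>2 + 2 * inner (S i) (f i w) + (norm (f i w))\<^sup>2)"
    have h: "h w = (\<Sum>i\<in>I. (norm (S i + f i w))\<^sup>2)" for w
      unfolding h_def by (intro sum.cong refl)
        (simp add: power2_norm_eq_inner inner_add_left inner_add_right inner_commute)
    have inth: "integrable M h"
      unfolding h_def using int int2 by (intro Bochner_Integration.integrable_sum) auto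
    have "expectation h = (\<Sum>i\<in>I. (norm (S i))\<^sup>2 + 2 * inner (S i) (expectation (f i))
             + expectation (\<lambda>w. (norm (f i w))\<^sup>2))"
      unfolding h_def using int int2
      by (subst Bochner_Integration.integral_sum) (auto simp: prob_space intro!: sum.cong)
    also have "\<dots> = (\<Sum>i\<in>I. (norm (S i))\<^sup>2) + V"
      by (simp add: mean V_def sum.distrib)
    finally show ?thesis
      using exists_le_expectation[OF inth] by (auto simp: h)
  qed
  define next_pt where "next_pt = (\<lambda>S :: 'i \<Rightarrow> 'b. SOME w. (\<Sum>i\<in>I. (norm (S i + f i w))\<^sup>2) \<le> (\<Sum>i\<in>I. (norm (S i))\<^sup>2) + V)"
  have next_pt: "(\<Sum>i\<in>I. (norm (S i + f i (next_pt S)))\<^sup>2) \<le> (\<Sum>i\<in>I. (norm (S i))\<^sup>2) + V" for S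
    unfolding next_pt_def using step by (rule someI_ex)
  define S where "S = rec_nat (\<lambda>_. 0) (\<lambda>_ s i. s i + f i (next_pt s))"
  have S_Suc: "S (Suc k) = (\<lambda>i. S k i + f i (next_pt (S k)))" for k
    by (simp add: S_def)
  have S_sum: "S l i = (\<Sum>k<l. f i (next_pt (S k)))" for l i
    by (induction l) (simp_all add: S_Suc, simp add: S_def)
  have "(\<Sum>i\<in>I. (norm (S l i))\<^sup>2) \<le> real l * V" for l
  proof (induction l)
    case 0
    then show ?case by (simp add: S_def)
  next
    case (Suc l)
    with next_pt[of "S l"] show ?case
      by (simp add: S_Suc algebra_simps)
  qed
  then show ?thesis
    by (intro exI[of _ "\<lambda>k. next_pt (S k)"]) (simp add: S_sum V_def)
qed

text \<open>The weak law of large numbers in existential form: after centring, the sums of length \<open>l\<close> have size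
\<open>O(sqrt l)\<close>, which division by \<open>l\<close> makes small.\<close>

lemma (in prob_space) simultaneous_sampling:
  fixes f :: "'i \<Rightarrow> 'a \<Rightarrow> 'b::{real_inner,banach,second_countable_topology}"
  assumes "finite I"
    and int: "\<And>i. i \<in> I \<Longrightarrow> integrable M (f i)"
    and int2: "\<And>i. i \<in> I \<Longrightarrow> integrable M (\<lambda>\<omega>. (norm (f i \<omega>))\<^sup>2)"
    and "\<delta> > 0"
  shows "\<exists>l\<ge>1. \<exists>\<omega> :: nat \<Rightarrow> 'a. \<forall>i\<in>I.
           norm ((\<Sum>k<l. f i (\<omega> k)) /\<^sub>R real l - expectation (f i)) \<le> \<delta>"
proof -
  define f' where "f' = (\<lambda>i w. f i w - expectation (f i))"
  have i1: "integrable M (f' i)" if "i \<in> I" for i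
    using int[OF that] unfolding f'_def by auto
  have i2: "integrable M (\<lambda>w. (norm (f' i w))\<^sup>2)" if "i \<in> I" for i
  proof -
    have "(norm (f' i w))\<^sup>2 = (norm (f i w))\<^sup>2 - 2 * inner (f i w) (expectation (f i)) + (norm (expectation (f i)))\<^sup>2" for w
      unfolding f'_def
      by (simp add: power2_norm_eq_inner inner_diff_left inner_diff_right inner_commute)
    then show ?thesis using int[OF that] int2[OF that] by simp
  qed
  have m: "expectation (f' i) = 0" if "i \<in> I" for i
    using int[OF that] unfolding f'_def by (simp add: prob_space)
  define V where "V = (\<Sum>i\<in>I. expectation (\<lambda>w. (norm (f' i w))\<^sup>2))"
  obtain w :: "nat \<Rightarrow> 'a" where w: "\<And>l. (\<Sum>i\<in>I. (norm (\<Sum>k<l. f' i (w k)))\<^sup>2) \<le> real l * V"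
    using greedy_sampling[of I f', OF \<open>finite I\<close> i1 i2 m] unfolding V_def by blast
  obtain l0 :: nat where l0: "V / \<delta>\<^sup>2 \<le> real l0" using real_arch_simple by blast
  define l where "l = Suc l0"
  have l: "V \<le> real l * \<delta>\<^sup>2" and "l \<ge> 1"
    using l0 \<open>\<delta> > 0\<close> by (simp_all add: l_def field_simps add_increasing)
  have "norm ((\<Sum>k<l. f i (w k)) /\<^sub>R real l - expectation (f i)) \<le> \<delta>" if "i \<in> I" for i
  proof -
    have "(norm (\<Sum>k<l. f' i (w k)))\<^sup>2 \<le> (\<Sum>i\<in>I. (norm (\<Sum>k<l. f' i (w k)))\<^sup>2)"
      using \<open>finite I\<close> that by (intro member_le_sum) auto
    also have "\<dots> \<le> real l * V" by (rule w)
    also have "\<dots> \<le> real l * (real l * \<delta>\<^sup>2)" using l by (intro mult_left_mono) auto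
    also have "\<dots> = (real l * \<delta>)\<^sup>2" by (simp add: power2_eq_square)
    finally have le: "norm (\<Sum>k<l. f' i (w k)) \<le> real l * \<delta>"
      by (rule power2_le_imp_le) (use \<open>\<delta> > 0\<close> in simp)
    have "(\<Sum>k<l. f i (w k)) /\<^sub>R real l - expectation (f i) = (\<Sum>k<l. f' i (w k)) /\<^sub>R real l"
      using \<open>l \<ge> 1\<close> by (simp add: f'_def sum_subtractf scaleR_diff_right sum_constant_scaleR)
    then show ?thesis using le \<open>l \<ge> 1\<close> by (simp add: field_simps)
  qed
  then show ?thesis using \<open>l \<ge> 1\<close> by blast
qed

section \<open>Independent standard normal variables\<close>

lemma (in prob_space) std_normal_unit_combination:
  fixes u :: "'i \<Rightarrow> 'a \<Rightarrow> real"
  assumes "finite I" and indep: "indep_vars (\<lambda>_. borel) u I"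
    and std: "\<And>p. p \<in> I \<Longrightarrow> distributed M lborel (u p) std_normal_density"
    and unit: "(\<Sum>p\<in>I. (a p)\<^sup>2) = 1"
  shows "distributed M lborel (\<lambda>\<omega>. \<Sum>p\<in>I. a p * u p \<omega>) std_normal_density"
proof -
  define J where "J = {p \<in> I. a p \<noteq> 0}"
  have J: "finite J" "J \<subseteq> I" using \<open>finite I\<close> by (auto simp: J_def)
  have sumJ: "(\<Sum>p\<in>I. (a p)\<^sup>2) = (\<Sum>p\<in>J. (a p)\<^sup>2)" "(\<Sum>p\<in>I. a p * u p w) = (\<Sum>p\<in>J. a p * u p w)" for w
    unfolding J_def using \<open>finite I\<close> by (auto intro!: sum.mono_neutral_right)
  then have "J \<noteq> {}" using unit by auto
  have "distributed M lborel (\<lambda>\<omega>. \<Sum>p\<in>J. a p * u p \<omega>)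
      (normal_density (\<Sum>p\<in>J. 0) (sqrt (\<Sum>p\<in>J. \<bar>a p\<bar>\<^sup>2)))"
  proof (rule sum_indep_normal[OF J(1) \<open>J \<noteq> {}\<close>])
    show "indep_vars (\<lambda>i. borel) (\<lambda>p \<omega>. a p * u p \<omega>) J"
      using indep_vars_compose2[OF indep_vars_subset[OF indep J(2)], of "\<lambda>p x. a p * x" "\<lambda>_. borel"]
      by simp
    show "distributed M lborel (\<lambda>\<omega>. a p * u p \<omega>) (normal_density 0 \<bar>a p\<bar>)" if "p \<in> J" for p
      using normal_density_affine[OF std[of p], of "a p" 0] that by (auto simp: J_def)
  qed (auto simp: J_def)
  then show ?thesis using unit by (simp add: sumJ)
qed

lemma exists_std_normal_family:
  fixes I :: "'i set"
  assumes "finite I" "I \<noteq> {}"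
  shows "\<exists>(M :: ('i \<Rightarrow> real) measure) u. prob_space M \<and> prob_space.indep_vars M (\<lambda>_. borel) u I
           \<and> (\<forall>p\<in>I. distributed M lborel (u p) std_normal_density)"
proof -
  define N where "N = density lborel (\<lambda>x. ennreal (std_normal_density x))"
  interpret N: prob_space N unfolding N_def by (rule prob_space_normal_density) simp
  interpret P: product_prob_space "\<lambda>_::'i. N" I ..
  define P where "P = (\<Pi>\<^sub>M p\<in>I. N)"
  interpret PS: prob_space P unfolding P_def by (rule P.prob_space_axioms)
  have setsN: "sets N = sets borel" by (simp add: N_def)
  have [measurable]: "(\<lambda>\<omega>. \<omega> p) \<in> borel_measurable P" if "p \<in> I" for p
    using measurable_component_singleton[OF that, of "\<lambda>_. N"] setsN
    by (simp add: P_def cong: measurable_cong_sets)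
  have distr: "distr P borel (\<lambda>\<omega>. \<omega> p) = N" if "p \<in> I" for p
  proof -
    have "distr P borel (\<lambda>\<omega>. \<omega> p) = distr P N (\<lambda>\<omega>. \<omega> p)"
      by (rule distr_cong) (simp_all add: setsN)
    then show ?thesis
      using distr_PiM_component[of I "\<lambda>_. N" p] that \<open>finite I\<close> N.prob_space_axioms
      by (simp add: P_def)
  qed
  have "PS.indep_vars (\<lambda>_. borel) (\<lambda>p \<omega>. \<omega> p) I"
  proof (subst PS.indep_vars_iff_distr_eq_PiM'[OF \<open>I \<noteq> {}\<close>])
    have "distr P (\<Pi>\<^sub>M i\<in>I. borel) (\<lambda>x. \<lambda>i\<in>I. x i) = distr P P (\<lambda>x. x)"
    proof (rule distr_cong)
      show "sets (\<Pi>\<^sub>M i\<in>I. borel) = sets P"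
        unfolding P_def by (rule sets_PiM_cong) (simp_all add: setsN)
      show "(\<lambda>i\<in>I. x i) = x" if "x \<in> space P" for x
        using that by (auto simp: P_def space_PiM PiE_def extensional_restrict)
    qed simp
    also have "\<dots> = P" by simp
    also have "\<dots> = (\<Pi>\<^sub>M i\<in>I. distr P borel (\<lambda>\<omega>. \<omega> i))"
      unfolding P_def by (rule PiM_cong) (simp_all add: distr flip: P_def)
    finally show "distr P (\<Pi>\<^sub>M i\<in>I. borel) (\<lambda>x. \<lambda>i\<in>I. x i) = (\<Pi>\<^sub>M i\<in>I. distr P borel (\<lambda>\<omega>. \<omega> i))" .
  qed simp
  moreover have "distributed P lborel (\<lambda>\<omega>. \<omega> p) std_normal_density" if "p \<in> I" for p
  proof -
    have "distr P lborel (\<lambda>\<omega>. \<omega> p) = distr P borel (\<lambda>\<omega>. \<omega> p)"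
      by (rule distr_cong) simp_all
    then show ?thesis using that distr[OF that] unfolding distributed_def N_def by simp
  qed
  ultimately show ?thesis using PS.prob_space_axioms by blast
qed

section \<open>Modulus and phase of a complex number\<close>

lemma integral_abs_cos_shift:
  assumes "0 \<le> \<phi>" "\<phi> \<le> pi"
  shows "((\<lambda>t. \<bar>cos (t - \<phi>)\<bar>) has_integral 2) {0..pi}"
proof -
  have pos: "((\<lambda>t. \<bar>cos (t - \<phi>)\<bar>) has_integral (sin (b - \<phi>) - sin (a - \<phi>))) {a..b}"
    if "a \<le> b" "\<phi> - pi/2 \<le> a" "b \<le> \<phi> + pi/2" for a b
  proof -
    have "((\<lambda>t. cos (t - \<phi>)) has_integral (sin (b - \<phi>) - sin (a - \<phi>))) {a..b}"
      by (rule fundamental_theorem_of_calculus[OF that(1)])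
        (auto intro!: derivative_eq_intros simp flip: has_real_derivative_iff_has_vector_derivative)
    then show ?thesis
      by (rule has_integral_eq[rotated]) (use that in \<open>auto intro!: abs_of_nonneg[symmetric] cos_ge_zero\<close>)
  qed
  have neg: "((\<lambda>t. \<bar>cos (t - \<phi>)\<bar>) has_integral (sin (a - \<phi>) - sin (b - \<phi>))) {a..b}"
    if "a \<le> b" "\<phi> + pi/2 \<le> a \<and> b \<le> pi + \<phi> \<or> \<phi> - pi \<le> a \<and> b \<le> \<phi> - pi/2" for a b
  proof -
    have "((\<lambda>t. - cos (t - \<phi>)) has_integral (- sin (b - \<phi>) - - sin (a - \<phi>))) {a..b}"
      by (rule fundamental_theorem_of_calculus[OF that(1)])
        (auto intro!: derivative_eq_intros simp flip: has_real_derivative_iff_has_vector_derivative)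
    moreover have "- cos (t - \<phi>) = \<bar>cos (t - \<phi>)\<bar>" if "t \<in> {a..b}" for t
    proof -
      have "cos (t - \<phi>) \<le> 0"
        using \<open>\<phi> + pi/2 \<le> a \<and> b \<le> pi + \<phi> \<or> \<phi> - pi \<le> a \<and> b \<le> \<phi> - pi/2\<close> that
        using cos_ge_zero[of "t - \<phi> - pi"] cos_ge_zero[of "t - \<phi> + pi"] by auto
      then show ?thesis by auto
    qed
    ultimately show ?thesis
      by (metis (no_types, lifting) has_integral_eq diff_minus_eq_add add.commute uminus_add_conv_diff)
  qed
  show ?thesis
  proof (cases "\<phi> \<le> pi/2")
    case True
    have "((\<lambda>t. \<bar>cos (t - \<phi>)\<bar>) has_integral
        ((sin (\<phi> + pi/2 - \<phi>) - sin (0 - \<phi>)) + (sin (\<phi> + pi/2 - \<phi>) - sin (pi - \<phi>)))) {0..pi}"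
      by (rule has_integral_combine[of _ "\<phi> + pi/2"], use True assms in simp, use True in simp)
        (use pos[of 0 "\<phi> + pi/2"] neg[of "\<phi> + pi/2" pi] True assms in auto)
    then show ?thesis by (simp add: sin_diff)
  next
    case False
    have "((\<lambda>t. \<bar>cos (t - \<phi>)\<bar>) has_integral
        ((sin (0 - \<phi>) - sin (\<phi> - pi/2 - \<phi>)) + (sin (pi - \<phi>) - sin (\<phi> - pi/2 - \<phi>)))) {0..pi}"
      by (rule has_integral_combine[of _ "\<phi> - pi/2"], use False assms in simp, use assms in simp)
        (use neg[of 0 "\<phi> - pi/2"] pos[of "\<phi> - pi/2" pi] False assms in auto)
    then show ?thesis by (simp add: sin_diff)
  qed
qed


text \<open>The modulus as an average of moduli of real parts. It turns absolute moments of complex Gaussian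
variables into those of real ones.\<close>

lemma integral_abs_Re_rotation:
  "((\<lambda>t. \<bar>Re (cis (- t) * z)\<bar>) has_integral 2 * cmod z) {0..pi}"
proof -
  have upper: "((\<lambda>t. \<bar>Re (cis (- t) * z)\<bar>) has_integral 2 * cmod z) {0..pi}" if "Im z \<ge> 0" for z
  proof -
    have "0 \<le> Arg z" "Arg z \<le> pi"
      using that by (simp_all add: Arg_less_0 Arg_le_pi)
    have "Re (cis (- t) * z) = cmod z * cos (t - Arg z)" for t
      by (subst (1) rcis_cmod_Arg[of z, symmetric])
        (simp add: rcis_def cis_mult algebra_simps cos_diff flip: cis_mult)
    then have "(\<lambda>t. \<bar>Re (cis (- t) * z)\<bar>) = (\<lambda>t. cmod z * \<bar>cos (t - Arg z)\<bar>)"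
      by (simp add: abs_mult)
    then show ?thesis
      using has_integral_mult_right[OF integral_abs_cos_shift[OF \<open>0 \<le> Arg z\<close> \<open>Arg z \<le> pi\<close>], of "cmod z"]
      by (simp add: mult.commute)
  qed
  show ?thesis
  proof (cases "Im z \<ge> 0")
    case False
    moreover have "\<bar>Re (cis (- t) * - z)\<bar> = \<bar>Re (cis (- t) * z)\<bar>" for t
      by (metis abs_minus_cancel mult_minus_right uminus_complex.sel(1))
    ultimately show ?thesis using upper[of "- z"] by (metis (no_types, lifting) has_integral_cong linear neg_0_le_iff_le norm_minus_cancel uminus_complex.sel(2))
  qed (rule upper)
qed

text \<open>The unimodular factor that rotates \<open>z\<close> onto the nonnegative reals. The value at 0 is unimodular too,
because these numbers become entries of \<open>Z\<close>.\<close>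

definition phase_conj :: "complex \<Rightarrow> complex" where
  "phase_conj z = (if z = 0 then 1 else cnj z / cmod z)"

lemma norm_phase_conj [simp]: "cmod (phase_conj z) = 1"
  by (simp add: phase_conj_def norm_divide)

lemma phase_conj_mult_self: "phase_conj z * z = cmod z"
  using complex_norm_square[of z]
  by (simp add: phase_conj_def mult.commute[of "cnj z"] power2_eq_square flip: complex_norm_square)

lemma borel_measurable_phase_conj [measurable]: "phase_conj \<in> borel_measurable borel"
proof -
  have [measurable]: "cnj \<in> borel_measurable borel"
    by (intro borel_measurable_continuous_onI continuous_intros)
  have [measurable]: "(\<lambda>x. complex_of_real (cmod x)) \<in> borel_measurable borel"
    by (intro borel_measurable_continuous_onI continuous_intros)
  have [measurable]: "{z :: complex \<in> space borel. z = 0} \<in> sets borel" by simp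
  show ?thesis unfolding phase_conj_def by measurable
qed

lemma norm_add_ge_subgradient: "cmod z + Re (phase_conj z * w) \<le> cmod (z + w)"
proof -
  have "cmod z + Re (phase_conj z * w) = Re (phase_conj z * (z + w))"
    by (simp add: distrib_left phase_conj_mult_self)
  also have "\<dots> \<le> cmod (phase_conj z * (z + w))" by (rule complex_Re_le_cmod)
  also have "\<dots> = cmod (z + w)" by (simp add: norm_mult)
  finally show ?thesis .
qed

lemma sqrt_one_add_le: "0 \<le> 1 + r \<Longrightarrow> sqrt (1 + r) \<le> 1 + r / 2"
  using arith_geo_mean_sqrt[of 1 "1 + r"] by (simp add: field_simps)

text \<open>Near \<open>t = 0\<close> the quadratic term is negligible; positive \<open>t\<close> give \<open>a \<le> b\<close> and negative \<open>t\<close> the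
converse. This is the uniqueness of the subgradient at a point of differentiability.\<close>

lemma linear_le_quadratic_imp_eq:
  fixes a b c :: real
  assumes "\<And>t. t * a \<le> t * b + t\<^sup>2 * c"
  shows "a = b"
proof (rule ccontr)
  assume "a \<noteq> b"
  define t where "t = (a - b) / (\<bar>c\<bar> + 1)"
  have "t * (a - b) \<le> t\<^sup>2 * c" using assms[of t] by (simp add: algebra_simps)
  also have "\<dots> \<le> t\<^sup>2 * \<bar>c\<bar>" by (intro mult_left_mono) auto
  also have "\<dots> < t\<^sup>2 * (\<bar>c\<bar> + 1)" 
  proof -
    have "0 < t\<^sup>2" using \<open>a \<noteq> b\<close> by (simp add: t_def add_nonneg_eq_0_iff)
    then show ?thesis by (simp add: distrib_left)
  qed
  also have "\<dots> = t * (t * (\<bar>c\<bar> + 1))" by (simp add: power2_eq_square)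
  also have "t * (\<bar>c\<bar> + 1) = a - b" by (simp add: t_def add_nonneg_eq_0_iff)
  finally show False by simp
qed

section \<open>The complex Gaussian vector\<close>

text \<open>
The variable \<open>u (i, False)\<close> is the real part and \<open>u (i, True)\<close> the imaginary part of the \<open>i\<close>-th
coordinate. They are not scaled, so a coordinate has \<open>E |g|^2 = 2\<close>.
\<close>

locale gaussian_vector = prob_space M for M :: "'a measure" +
  fixes d :: nat and u :: "nat \<times> bool \<Rightarrow> 'a \<Rightarrow> real"
  assumes indep: "indep_vars (\<lambda>_. borel) u ({..<d} \<times> UNIV)"
    and std: "\<And>p. p \<in> {..<d} \<times> UNIV \<Longrightarrow> distributed M lborel (u p) std_normal_density"
begin

lemma u_measurable [measurable]: "p \<in> {..<d} \<times> UNIV \<Longrightarrow> u p \<in> borel_measurable M"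
  using distributed_measurable[OF std[of p]] by simp

lemma combination_moments:
  assumes "(\<Sum>p\<in>{..<d} \<times> UNIV. (a p)\<^sup>2) = 1"
  defines "S \<equiv> \<lambda>\<omega>. \<Sum>p\<in>{..<d} \<times> UNIV. a p * u p \<omega>"
  shows "integrable M (\<lambda>\<omega>. S \<omega> ^ k)" "expectation (\<lambda>\<omega>. (S \<omega>)\<^sup>2) = 1"
    and "expectation (\<lambda>\<omega>. \<bar>S \<omega>\<bar>) = sqrt (2 / pi)"
proof -
  have D: "distributed M lborel S (\<lambda>x. ennreal (std_normal_density x))"
    unfolding S_def using std_normal_unit_combination[OF _ indep std assms(1)] by simp
  show "integrable M (\<lambda>\<omega>. S \<omega> ^ k)"
    using distributed_integrable[OF D, of "\<lambda>x. x ^ k"] integrable_std_normal_moment[of k] by simp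
  show "expectation (\<lambda>\<omega>. (S \<omega>)\<^sup>2) = 1"
    using distributed_integral[OF D, of "\<lambda>x. x\<^sup>2"] integral_std_normal_moment_even[of 1] by simp
  show "expectation (\<lambda>\<omega>. \<bar>S \<omega>\<bar>) = sqrt (2 / pi)"
    using distributed_integral[OF D, of "\<lambda>x. \<bar>x\<bar>"] integral_std_normal_moment_abs_odd[of 0] by simp
qed

lemma coordinate_combination:
  assumes "p \<in> {..<d} \<times> UNIV"
  shows "(\<Sum>q\<in>{..<d} \<times> UNIV. (if q = p then b else 0) * u q \<omega>) = b * u p \<omega>"
    and "(\<Sum>q\<in>{..<d} \<times> (UNIV :: bool set). (if q = p then b else 0 :: real)\<^sup>2) = b\<^sup>2"
  using assms by (simp_all add: if_distrib[of "\<lambda>x. x * _"] if_distrib[of "\<lambda>x. x\<^sup>2"] sum.delta cong: if_cong)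

lemma coordinate_moments:
  assumes "p \<in> {..<d} \<times> UNIV"
  shows "integrable M (\<lambda>\<omega>. u p \<omega> ^ k)" "expectation (\<lambda>\<omega>. (u p \<omega>)\<^sup>2) = 1"
  using combination_moments(1,2)[of "\<lambda>q. if q = p then 1 else 0"] coordinate_combination[OF assms, of 1]
  by simp_all

lemma coordinate_uncorrelated:
  assumes "p \<in> {..<d} \<times> UNIV" "q \<in> {..<d} \<times> UNIV"
  shows "integrable M (\<lambda>\<omega>. u p \<omega> * u q \<omega>)"
    and "expectation (\<lambda>\<omega>. u p \<omega> * u q \<omega>) = (if p = q then 1 else 0)"
proof -
  show int: "integrable M (\<lambda>\<omega>. u p \<omega> * u q \<omega>)"
  proof (rule Bochner_Integration.integrable_bound)
    show "integrable M (\<lambda>\<omega>. (u p \<omega>)\<^sup>2 + (u q \<omega>)\<^sup>2)"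
      using assms coordinate_moments(1) by simp
    show "AE \<omega> in M. norm (u p \<omega> * u q \<omega>) \<le> norm ((u p \<omega>)\<^sup>2 + (u q \<omega>)\<^sup>2)"
    proof (intro AE_I2)
      fix \<omega>
      have "2 * (\<bar>u p \<omega>\<bar> * \<bar>u q \<omega>\<bar>) \<le> (u p \<omega>)\<^sup>2 + (u q \<omega>)\<^sup>2"
        using sum_squares_bound[of "\<bar>u p \<omega>\<bar>" "\<bar>u q \<omega>\<bar>"] by simp
      moreover have "0 \<le> \<bar>u p \<omega>\<bar> * \<bar>u q \<omega>\<bar>" by simp
      ultimately show "norm (u p \<omega> * u q \<omega>) \<le> norm ((u p \<omega>)\<^sup>2 + (u q \<omega>)\<^sup>2)"
        unfolding real_norm_def abs_mult by linarith
    qed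
  qed (use assms in measurable)
  show "expectation (\<lambda>\<omega>. u p \<omega> * u q \<omega>) = (if p = q then 1 else 0)"
  proof (cases "p = q")
    case True
    then show ?thesis using coordinate_moments(2)[OF assms(1)] by (simp add: power2_eq_square)
  next
    case False
    \<comment> \<open>The law is known for unit combinations only: \<open>3/5\<close> and \<open>4/5\<close> are rational coefficients of
       one that involves both variables, and its variance isolates the mixed moment.\<close>
    define a where "a = (\<lambda>r. (if r = p then 3/5 else 0) + (if r = q then 4/5 else 0 :: real))"
    have "(a r)\<^sup>2 = (if r = p then 3/5 else 0)\<^sup>2 + (if r = q then 4/5 else 0)\<^sup>2" for r
      using False by (simp add: a_def)
    then have a: "(\<Sum>r\<in>{..<d} \<times> UNIV. (a r)\<^sup>2) = 1"
      using coordinate_combination(2)[OF assms(1)] coordinate_combination(2)[OF assms(2)]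
      by (simp add: sum.distrib power2_eq_square)
    have S: "(\<Sum>r\<in>{..<d} \<times> UNIV. a r * u r \<omega>) = 3/5 * u p \<omega> + 4/5 * u q \<omega>" for \<omega>
      using coordinate_combination(1)[OF assms(1)] coordinate_combination(1)[OF assms(2)]
      by (simp add: a_def distrib_right sum.distrib)
    have "1 = expectation (\<lambda>\<omega>. (3/5 * u p \<omega> + 4/5 * u q \<omega>)\<^sup>2)"
      using combination_moments(2)[OF a] by (simp add: S)
    also have "(\<lambda>\<omega>. (3/5 * u p \<omega> + 4/5 * u q \<omega>)\<^sup>2)
        = (\<lambda>\<omega>. 9/25 * (u p \<omega>)\<^sup>2 + 16/25 * (u q \<omega>)\<^sup>2 + 24/25 * (u p \<omega> * u q \<omega>))"
      by (simp add: power2_eq_square algebra_simps)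
    also have "expectation \<dots> = 9/25 + 16/25 + 24/25 * expectation (\<lambda>\<omega>. u p \<omega> * u q \<omega>)"
      using int coordinate_moments[OF assms(1)] coordinate_moments[OF assms(2)] by simp
    finally show ?thesis using False by simp
  qed
qed

definition g :: "nat \<Rightarrow> 'a \<Rightarrow> complex" where
  "g i \<omega> = Complex (u (i, False) \<omega>) (u (i, True) \<omega>)"

definition h :: "(nat \<Rightarrow> complex) \<Rightarrow> 'a \<Rightarrow> complex" where
  "h x \<omega> = (\<Sum>i<d. cnj (x i) * g i \<omega>)"

lemma g_measurable [measurable]: "i < d \<Longrightarrow> g i \<in> borel_measurable M"
  unfolding g_def borel_measurable_complex_iff by simp

lemma h_measurable [measurable]: "h x \<in> borel_measurable M"
  unfolding h_def by measurable

lemma g_second_moments: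
  assumes "i < d" "j < d"
  shows "integrable M (\<lambda>\<omega>. g i \<omega> * cnj (g j \<omega>))"
    and "expectation (\<lambda>\<omega>. g i \<omega> * cnj (g j \<omega>)) = (if i = j then 2 else 0)"
proof -
  have eq: "g i \<omega> * cnj (g j \<omega>) =
      of_real (u (i, False) \<omega> * u (j, False) \<omega> + u (i, True) \<omega> * u (j, True) \<omega>)
      + \<i> * of_real (u (i, True) \<omega> * u (j, False) \<omega> - u (i, False) \<omega> * u (j, True) \<omega>)" for \<omega>
    by (simp add: g_def complex_eq_iff)
  show "integrable M (\<lambda>\<omega>. g i \<omega> * cnj (g j \<omega>))"
    unfolding eq using assms
    by (intro Bochner_Integration.integrable_add integrable_mult_right integrable_of_real
        Bochner_Integration.integrable_diff coordinate_uncorrelated(1)) auto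
  show "expectation (\<lambda>\<omega>. g i \<omega> * cnj (g j \<omega>)) = (if i = j then 2 else 0)"
    unfolding eq using assms by (simp add: coordinate_uncorrelated del: of_real_mult of_real_add of_real_diff)
qed

lemma integrable_g:
  assumes "i < d"
  shows "integrable M (\<lambda>\<omega>. (cmod (g i \<omega>))\<^sup>2)" "integrable M (\<lambda>\<omega>. (cmod (g i \<omega>)) ^ 4)" "integrable M (g i)"
proof -
  have sq: "(cmod (g i \<omega>))\<^sup>2 = (u (i, False) \<omega>)\<^sup>2 + (u (i, True) \<omega>)\<^sup>2" for \<omega>
    by (simp add: g_def cmod_power2)
  show "integrable M (\<lambda>\<omega>. (cmod (g i \<omega>))\<^sup>2)"
    unfolding sq using coordinate_moments(1) assms by simp
  show "integrable M (\<lambda>\<omega>. (cmod (g i \<omega>)) ^ 4)"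
  proof (rule Bochner_Integration.integrable_bound)
    show "integrable M (\<lambda>\<omega>. 2 * u (i, False) \<omega> ^ 4 + 2 * u (i, True) \<omega> ^ 4)"
      using assms coordinate_moments(1) by simp
    show "AE \<omega> in M. norm ((cmod (g i \<omega>)) ^ 4) \<le> norm (2 * u (i, False) \<omega> ^ 4 + 2 * u (i, True) \<omega> ^ 4)"
    proof (intro AE_I2)
      fix \<omega>
      have "(cmod (g i \<omega>)) ^ 4 = ((u (i, False) \<omega>)\<^sup>2 + (u (i, True) \<omega>)\<^sup>2)\<^sup>2"
        unfolding sq[symmetric] by (simp flip: power_mult)
      also have "\<dots> \<le> 2 * u (i, False) \<omega> ^ 4 + 2 * u (i, True) \<omega> ^ 4"
        using sum_squares_bound[of "(u (i, False) \<omega>)\<^sup>2" "(u (i, True) \<omega>)\<^sup>2"]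
        by (simp add: power2_sum flip: power_mult)
      finally show "norm ((cmod (g i \<omega>)) ^ 4) \<le> norm (2 * u (i, False) \<omega> ^ 4 + 2 * u (i, True) \<omega> ^ 4)"
        by simp
    qed
  qed (use assms in measurable)
  show "integrable M (g i)"
  proof -
    have "g i = (\<lambda>\<omega>. of_real (u (i, False) \<omega>) + \<i> * of_real (u (i, True) \<omega>))"
      by (simp add: fun_eq_iff g_def complex_eq_iff)
    then show ?thesis
      using coordinate_moments(1)[of "(i, False)" 1] coordinate_moments(1)[of "(i, True)" 1] assms
      by (simp del: Bochner_Integration.integrable_mult_right_iff
          add: Bochner_Integration.integrable_add integrable_mult_right integrable_of_real)
  qed
qed

lemma integrable_h: "integrable M (h x)"
  unfolding h_def
  by (intro Bochner_Integration.integrable_sum integrable_mult_right integrable_g(3)) simp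

text \<open>The real part of \<open>c * h x\<close> is a real combination of the \<open>2 d\<close> variables \<open>u\<close> whose coefficient
vector has the length of \<open>x\<close>, hence itself a standard normal variable.\<close>

lemma expectation_abs_Re_h:
  assumes "(\<Sum>i<d. (cmod (x i))\<^sup>2) = 1" and "cmod c = 1"
  shows "expectation (\<lambda>\<omega>. \<bar>Re (c * h x \<omega>)\<bar>) = sqrt (2 / pi)"
proof -
  define a where "a = (\<lambda>(i, b). if b then - Im (c * cnj (x i)) else Re (c * cnj (x i)))"
  have split: "(\<Sum>p\<in>{..<d} \<times> (UNIV :: bool set). F p) = (\<Sum>i<d. F (i, False) + F (i, True))"
    for F :: "_ \<Rightarrow> real"
    by (subst sum.cartesian_product') (simp add: UNIV_bool add.commute)
  have "(\<Sum>p\<in>{..<d} \<times> UNIV. (a p)\<^sup>2) = (\<Sum>i<d. (cmod (c * cnj (x i)))\<^sup>2)"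
    unfolding split by (intro sum.cong refl) (simp only: a_def cmod_power2 prod.case if_True if_False power2_minus)
  then have a: "(\<Sum>p\<in>{..<d} \<times> UNIV. (a p)\<^sup>2) = 1"
    using assms by (simp add: norm_mult)
  have "c * h x \<omega> = (\<Sum>i<d. (c * cnj (x i)) * g i \<omega>)" for \<omega>
    by (simp add: h_def sum_distrib_left mult.assoc)
  then have "Re (c * h x \<omega>) = (\<Sum>p\<in>{..<d} \<times> UNIV. a p * u p \<omega>)" for \<omega>
    unfolding split by (simp add: a_def g_def algebra_simps)
  then show ?thesis using combination_moments(3)[OF a] by simp
qed

text \<open>Integrate \<open>|Re (cis (- t) * h x)|\<close> over \<open>t\<close> in \<open>{0..pi}\<close> and over the probability space. In one order
the inner integral is \<open>2 |h x|\<close>; in the other it is the constant \<open>sqrt (2 / pi)\<close>.\<close>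

lemma expectation_norm_h_unit:
  assumes "(\<Sum>i<d. (cmod (x i))\<^sup>2) = 1"
  shows "expectation (\<lambda>\<omega>. cmod (h x \<omega>)) = sqrt (pi / 2)"
proof -
  interpret P: pair_sigma_finite M lborel ..
  define F where "F = (\<lambda>\<omega> t. ennreal \<bar>Re (cis (- t) * h x \<omega>)\<bar> * indicator {0..pi} t)"
  have [measurable]: "cis \<in> borel_measurable borel"
    by (intro borel_measurable_continuous_onI continuous_intros)
  have F [measurable]: "case_prod F \<in> borel_measurable (M \<Otimes>\<^sub>M lborel)"
    unfolding F_def by measurable
  have inner_t: "(\<integral>\<^sup>+t. F \<omega> t \<partial>lborel) = ennreal (2 * cmod (h x \<omega>))" for \<omega>
    unfolding F_def
    using nn_integral_has_integral_lebesgue'[OF _ integral_abs_Re_rotation[of "h x \<omega>"]]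
    by (simp add: nn_integral_completion)
  have inner_\<omega>: "(\<integral>\<^sup>+\<omega>. F \<omega> t \<partial>M) = ennreal (sqrt (2 / pi)) * indicator {0..pi} t" for t
  proof -
    have "integrable M (\<lambda>\<omega>. \<bar>Re (cis (- t) * h x \<omega>)\<bar>)"
      by (intro integrable_abs integrable_Re integrable_mult_right integrable_h)
    then have "(\<integral>\<^sup>+\<omega>. ennreal \<bar>Re (cis (- t) * h x \<omega>)\<bar> \<partial>M) = ennreal (sqrt (2 / pi))"
      by (subst nn_integral_eq_integral) (simp_all only: expectation_abs_Re_h[OF assms norm_cis] AE_I2 abs_ge_zero)
    then show ?thesis unfolding F_def by (subst nn_integral_multc) simp_all
  qed
  have "ennreal (2 * expectation (\<lambda>\<omega>. cmod (h x \<omega>))) = (\<integral>\<^sup>+\<omega>. ennreal (2 * cmod (h x \<omega>)) \<partial>M)"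
    using integrable_h[of x] by (subst nn_integral_eq_integral) auto
  also have "\<dots> = (\<integral>\<^sup>+\<omega>. \<integral>\<^sup>+t. F \<omega> t \<partial>lborel \<partial>M)"
    by (simp only: inner_t)
  also have "\<dots> = (\<integral>\<^sup>+t. \<integral>\<^sup>+\<omega>. F \<omega> t \<partial>M \<partial>lborel)"
    using P.Fubini'[OF F] by simp
  also have "\<dots> = ennreal (sqrt (2 / pi) * pi)"
    unfolding inner_\<omega> by (subst nn_integral_cmult_indicator) (simp_all add: ennreal_mult)
  also have "sqrt (2 / pi) * pi = 2 * sqrt (pi / 2)"
    by (simp add: real_sqrt_divide field_simps flip: power2_eq_square)
  finally show ?thesis
    by (subst (asm) ennreal_inj) auto
qed

lemma expectation_norm_h:
  "expectation (\<lambda>\<omega>. cmod (h x \<omega>)) = sqrt (pi / 2) * sqrt (\<Sum>i<d. (cmod (x i))\<^sup>2)"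
proof -
  define s where "s = sqrt (\<Sum>i<d. (cmod (x i))\<^sup>2)"
  have s2: "s\<^sup>2 = (\<Sum>i<d. (cmod (x i))\<^sup>2)" and "s \<ge> 0"
    by (simp_all add: s_def sum_nonneg)
  show ?thesis
  proof (cases "s = 0")
    case True
    then have "x i = 0" if "i < d" for i
      using that s2 by (simp add: sum_nonneg_eq_0_iff)
    then have "h x \<omega> = 0" for \<omega> by (simp add: h_def)
    then show ?thesis using True by (simp add: s_def)
  next
    case False
    define y where "y = (\<lambda>i. x i / s)"
    have "(\<Sum>i<d. (cmod (y i))\<^sup>2) = 1"
      using False by (simp add: y_def norm_divide power_divide flip: sum_divide_distrib s2)
    moreover have "h x \<omega> = s * h y \<omega>" for \<omega>
      using False by (simp add: h_def y_def sum_distrib_left)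
    ultimately show ?thesis
      using expectation_norm_h_unit[of y] \<open>s \<ge> 0\<close> by (simp add: norm_mult flip: s_def)
  qed
qed

lemma integrable_phase_conj_mult:
  assumes "integrable M f"
  shows "integrable M (\<lambda>\<omega>. phase_conj (h x \<omega>) * f \<omega>)"
  by (rule Bochner_Integration.integrable_bound[OF assms])
    (use assms in \<open>auto simp: norm_mult\<close>)

text \<open>Take expectations in the subgradient inequality for the modulus at \<open>h x\<close> in direction \<open>t * h v\<close>.
Its terms are \<open>sqrt (pi / 2)\<close> times the lengths of \<open>x\<close> and \<open>x + t v\<close>, and the latter length is
\<open>1 + t Re \<langle>v, x\<rangle> + O(t^2)\<close>; comparing slopes at \<open>t = 0\<close> gives the claim.\<close>

lemma expectation_phase_conj_h:
  assumes unit: "(\<Sum>i<d. (cmod (x i))\<^sup>2) = 1"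
  shows "expectation (\<lambda>\<omega>. Re (phase_conj (h x \<omega>) * h v \<omega>))
           = sqrt (pi / 2) * Re (\<Sum>i<d. cnj (v i) * x i)" (is "?E = ?c * ?R")
proof (rule linear_le_quadratic_imp_eq)
  fix t :: real
  define V where "V = (\<Sum>i<d. (cmod (v i))\<^sup>2)"
  have h_add: "h (\<lambda>i. x i + t * v i) \<omega> = h x \<omega> + t * h v \<omega>" for \<omega>
    by (simp add: h_def algebra_simps sum.distrib sum_distrib_left)
  have "(\<Sum>i<d. (cmod (x i + t * v i))\<^sup>2)
      = (\<Sum>i<d. (cmod (x i))\<^sup>2 + 2 * (t * Re (cnj (v i) * x i)) + t\<^sup>2 * (cmod (v i))\<^sup>2)"
    unfolding cmod_power2 by (intro sum.cong refl) (simp add: power2_eq_square algebra_simps)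
  also have "\<dots> = 1 + 2 * (t * ?R) + t\<^sup>2 * V"
    by (simp only: sum.distrib unit V_def flip: sum_distrib_left Re_sum)
  finally have norm_sq: "(\<Sum>i<d. (cmod (x i + t * v i))\<^sup>2) = 1 + 2 * (t * ?R) + t\<^sup>2 * V" .
  have "sqrt (1 + 2 * (t * ?R) + t\<^sup>2 * V) \<le> 1 + (2 * (t * ?R) + t\<^sup>2 * V) / 2"
  proof -
    have "0 \<le> 1 + 2 * (t * ?R) + t\<^sup>2 * V" unfolding norm_sq[symmetric] by (intro sum_nonneg) simp
    then have "0 \<le> 1 + (2 * (t * ?R) + t\<^sup>2 * V)" by (simp only: add.assoc)
    from sqrt_one_add_le[OF this] show ?thesis by (simp only: add.assoc)
  qed
  then have "?c * sqrt (1 + 2 * (t * ?R) + t\<^sup>2 * V) \<le> ?c * (1 + (2 * (t * ?R) + t\<^sup>2 * V) / 2)"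
    by (intro mult_left_mono) auto
  moreover have "?c + t * ?E \<le> ?c * sqrt (1 + 2 * (t * ?R) + t\<^sup>2 * V)"
  proof -
    have int: "integrable M (\<lambda>\<omega>. Re (phase_conj (h x \<omega>) * h v \<omega>))"
      by (intro integrable_Re integrable_phase_conj_mult integrable_h)
    have "?c + t * ?E = expectation (\<lambda>\<omega>. cmod (h x \<omega>) + t * Re (phase_conj (h x \<omega>) * h v \<omega>))"
      using int integrable_h by (simp add: expectation_norm_h unit)
    also have "\<dots> \<le> expectation (\<lambda>\<omega>. cmod (h (\<lambda>i. x i + t * v i) \<omega>))"
    proof (rule integral_mono)
      show "cmod (h x \<omega>) + t * Re (phase_conj (h x \<omega>) * h v \<omega>) \<le> cmod (h (\<lambda>i. x i + t * v i) \<omega>)" for \<omega>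
        using norm_add_ge_subgradient[of "h x \<omega>" "t * h v \<omega>"]
        by (simp add: h_add mult.left_commute[of _ "complex_of_real t"])
    qed (use int integrable_h in \<open>auto intro!: Bochner_Integration.integrable_add\<close>)
    also have "\<dots> = ?c * sqrt (1 + 2 * (t * ?R) + t\<^sup>2 * V)"
      by (simp only: expectation_norm_h norm_sq)
    finally show ?thesis .
  qed
  moreover have "t * e \<le> t * (c * r) + q * (c * v / 2)"
    if "c * s \<le> c * (1 + (2 * (t * r) + q * v) / 2)" "c + t * e \<le> c * s" for c e q r s v :: real
    using that by (simp add: field_simps)
  ultimately show "t * ?E \<le> t * (?c * ?R) + t\<^sup>2 * (?c * V / 2)" by blast
qed

text \<open>Multiples of a coordinate vector as \<open>v\<close> in the preceding lemma; the multiples by 1 and \<open>\<i>\<close> give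
the real and the imaginary part.\<close>

lemma expectation_phase_conj_g:
  fixes x :: "nat \<Rightarrow> complex"
  assumes unit: "(\<Sum>i<d. (cmod (x i))\<^sup>2) = 1" and "i < d"
  shows "expectation (\<lambda>\<omega>. phase_conj (h x \<omega>) * g i \<omega>) = sqrt (pi / 2) * x i"
proof -
  define E where "E = expectation (\<lambda>\<omega>. phase_conj (h x \<omega>) * g i \<omega>)"
  have int: "integrable M (\<lambda>\<omega>. phase_conj (h x \<omega>) * g i \<omega>)"
    using integrable_g(3)[OF \<open>i < d\<close>] by (rule integrable_phase_conj_mult)
  have "Re (cnj a * E) = sqrt (pi / 2) * Re (cnj a * x i)" for a
  proof -
    define v where "v = (\<lambda>k. if k = i then a else 0)"
    have "h v \<omega> = cnj a * g i \<omega>" for \<omega>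
      using \<open>i < d\<close> by (simp add: h_def v_def if_distrib[of cnj] if_distrib[of "\<lambda>z. z * _"] cong: if_cong)
    moreover have "(\<Sum>k<d. cnj (v k) * x k) = cnj a * x i"
      using \<open>i < d\<close> by (simp add: v_def if_distrib[of cnj] if_distrib[of "\<lambda>z. z * _"] cong: if_cong)
    ultimately have "expectation (\<lambda>\<omega>. Re (cnj a * (phase_conj (h x \<omega>) * g i \<omega>))) = sqrt (pi / 2) * Re (cnj a * x i)"
      using expectation_phase_conj_h[OF unit, of v] by (simp only: mult.left_commute)
    moreover have "expectation (\<lambda>\<omega>. Re (cnj a * (phase_conj (h x \<omega>) * g i \<omega>))) = Re (cnj a * E)"
      unfolding E_def using int by (subst integral_Re) (simp_all only: integrable_mult_right integral_mult_right_zero)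
    ultimately show ?thesis by simp
  qed
  from this[of 1] this[of \<i>] show ?thesis
    unfolding E_def[symmetric] by (simp add: complex_eq_iff)
qed

text \<open>The fourth moments of \<open>g\<close> enter here: sampling the products \<open>g i * cnj (g i')\<close> requires
that they be square integrable.\<close>

lemma exists_samples:
  fixes x :: "'j \<Rightarrow> nat \<Rightarrow> complex"
  assumes "finite J" and unit: "\<And>j. j \<in> J \<Longrightarrow> (\<Sum>i<d. (cmod (x j i))\<^sup>2) = 1" and "\<delta> > 0"
  shows "\<exists>l\<ge>1. \<exists>(G :: nat \<Rightarrow> nat \<Rightarrow> complex) z.
    (\<forall>k j. cmod (z k j) = 1)
    \<and> (\<forall>j\<in>J. \<forall>i<d. cmod ((\<Sum>k<l. z k j * G k i) / of_nat l - sqrt (pi / 2) * x j i) \<le> \<delta>)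
    \<and> (\<forall>i<d. \<forall>i'<d. cmod ((\<Sum>k<l. G k i * cnj (G k i')) / of_nat l - (if i = i' then 2 else 0)) \<le> \<delta>)"
proof -
  define I where "I = (J \<times> {..<d}) <+> ({..<d} \<times> {..<d})"
  define f where "f = case_sum (\<lambda>(j, i) \<omega>. phase_conj (h (x j) \<omega>) * g i \<omega>) (\<lambda>(i, i') \<omega>. g i \<omega> * cnj (g i' \<omega>))"
  have "\<exists>l\<ge>1. \<exists>\<omega>. \<forall>p\<in>I. norm ((\<Sum>k<l. f p (\<omega> k)) /\<^sub>R real l - expectation (f p)) \<le> \<delta>"
  proof (rule simultaneous_sampling)
    show "finite I" using \<open>finite J\<close> by (simp add: I_def)
    show "integrable M (f p)" if "p \<in> I" for p
      using that by (auto simp: I_def f_def intro!: integrable_phase_conj_mult integrable_g g_second_moments)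
    show "integrable M (\<lambda>\<omega>. (norm (f p \<omega>))\<^sup>2)" if "p \<in> I" for p
    proof (cases p)
      case (Inl q)
      with that show ?thesis
        by (auto simp: I_def f_def norm_mult integrable_g split: prod.splits)
    next
      case (Inr q)
      with that obtain i i' where q: "q = (i, i')" "i < d" "i' < d" by (auto simp: I_def)
      show ?thesis
      proof (rule Bochner_Integration.integrable_bound)
        show "integrable M (\<lambda>\<omega>. cmod (g i \<omega>) ^ 4 + cmod (g i' \<omega>) ^ 4)"
          using integrable_g(2) q by simp
        show "AE \<omega> in M. norm ((norm (f p \<omega>))\<^sup>2) \<le> norm (cmod (g i \<omega>) ^ 4 + cmod (g i' \<omega>) ^ 4)"
        proof (intro AE_I2)
          fix \<omega>
          have "2 * ((cmod (g i \<omega>))\<^sup>2 * (cmod (g i' \<omega>))\<^sup>2) \<le> cmod (g i \<omega>) ^ 4 + cmod (g i' \<omega>) ^ 4"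
            using sum_squares_bound[of "(cmod (g i \<omega>))\<^sup>2" "(cmod (g i' \<omega>))\<^sup>2"] by (simp flip: power_mult)
          moreover have "0 \<le> (cmod (g i \<omega>))\<^sup>2 * (cmod (g i' \<omega>))\<^sup>2" by simp
          moreover have "(norm (f p \<omega>))\<^sup>2 = (cmod (g i \<omega>))\<^sup>2 * (cmod (g i' \<omega>))\<^sup>2"
            by (simp add: Inr q f_def norm_mult power_mult_distrib)
          moreover have "0 \<le> cmod (g i \<omega>) ^ 4 + cmod (g i' \<omega>) ^ 4" by simp
          ultimately show "norm ((norm (f p \<omega>))\<^sup>2) \<le> norm (cmod (g i \<omega>) ^ 4 + cmod (g i' \<omega>) ^ 4)"
            unfolding real_norm_def abs_power2 by linarith
        qed
        have [measurable]: "g i \<in> borel_measurable M" "g i' \<in> borel_measurable M"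
          using q by simp_all
        have [measurable]: "cnj \<in> borel_measurable borel"
          by (intro borel_measurable_continuous_onI continuous_intros)
        show "(\<lambda>\<omega>. (norm (f p \<omega>))\<^sup>2) \<in> borel_measurable M"
          by (simp add: Inr q f_def)
      qed
    qed
  qed fact
  then obtain l \<omega> where "l \<ge> 1"
    and *: "\<And>p. p \<in> I \<Longrightarrow> norm ((\<Sum>k<l. f p (\<omega> k)) /\<^sub>R real l - expectation (f p)) \<le> \<delta>"
    by blast
  have average: "S /\<^sub>R real l = S / of_nat l" for S :: complex
    by (simp add: scaleR_conv_of_real divide_inverse mult.commute)
  show ?thesis
  proof (intro exI conjI allI ballI impI)
    show "cmod (phase_conj (h (x j) (\<omega> k))) = 1" for j k by simp
    show "cmod ((\<Sum>k<l. phase_conj (h (x j) (\<omega> k)) * g i (\<omega> k)) / of_nat l - sqrt (pi / 2) * x j i) \<le> \<delta>"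
      if "j \<in> J" "i < d" for j i
    proof -
      have "Inl (j, i) \<in> I" using that by (auto simp: I_def)
      from *[OF this] show ?thesis
        unfolding average by (simp only: f_def sum.case prod.case expectation_phase_conj_g[OF unit[OF that(1)] that(2)])
    qed
    show "cmod ((\<Sum>k<l. g i (\<omega> k) * cnj (g i' (\<omega> k))) / of_nat l - (if i = i' then 2 else 0)) \<le> \<delta>"
      if "i < d" "i' < d" for i i'
    proof -
      have "Inr (i, i') \<in> I" using that by (auto simp: I_def)
      from *[OF this] show ?thesis
        unfolding average by (simp only: f_def sum.case prod.case g_second_moments(2)[OF that])
    qed
  qed fact
qed

end

lemma exists_gaussian_vector:
  assumes "d \<ge> 1"
  shows "\<exists>(M :: (nat \<times> bool \<Rightarrow> real) measure) u. gaussian_vector M d u"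
proof -
  have "{..<d} \<times> (UNIV :: bool set) \<noteq> {}" using assms by (auto simp: lessThan_empty_iff)
  from exists_std_normal_family[OF _ this]
  obtain M :: "(nat \<times> bool \<Rightarrow> real) measure" and u :: "nat \<times> bool \<Rightarrow> (nat \<times> bool \<Rightarrow> real) \<Rightarrow> real"
    where "prob_space M" "prob_space.indep_vars M (\<lambda>_. borel) u ({..<d} \<times> UNIV)"
      "\<forall>p\<in>{..<d} \<times> UNIV. distributed M lborel (u p) std_normal_density"
    by (auto simp del: ball_simps)
  then have "gaussian_vector M d u"
    by (intro gaussian_vector.intro gaussian_vector_axioms.intro) blast+
  then show ?thesis by blast
qed

section \<open>From samples to matrices\<close>

text \<open>The left-hand side is the quadratic form of the averaged Gram matrix. It differs from \<open>b |w|^2\<close> by at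
most \<open>\<delta> (\<Sum>i. |w i|)^2\<close>, which Cauchy-Schwarz bounds by \<open>d \<delta> |w|^2\<close>.\<close>

lemma quadratic_form_bound:
  fixes G :: "nat \<Rightarrow> nat \<Rightarrow> complex"
  assumes "l \<ge> 1" "\<delta> \<ge> 0"
    and gram: "\<And>i i'. i < d \<Longrightarrow> i' < d \<Longrightarrow>
        cmod ((\<Sum>k<l. G k i * cnj (G k i')) / of_nat l - (if i = i' then b else 0)) \<le> \<delta>"
  shows "(\<Sum>k<l. (cmod (\<Sum>i<d. cnj (w i) * G k i))\<^sup>2) / l \<le> (cmod b + real d * \<delta>) * (\<Sum>i<d. (cmod (w i))\<^sup>2)"
proof -
  define D where "D = (\<lambda>i i'. (\<Sum>k<l. G k i * cnj (G k i')) / of_nat l - (if i = i' then b else 0))"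
  have "of_real ((\<Sum>k<l. (cmod (\<Sum>i<d. cnj (w i) * G k i))\<^sup>2) / l)
      = (\<Sum>k<l. (\<Sum>i<d. cnj (w i) * G k i) * (\<Sum>i'<d. w i' * cnj (G k i'))) / of_nat l"
    by (simp add: complex_norm_square del: of_real_power)
  also have "\<dots> = (\<Sum>k<l. \<Sum>i<d. \<Sum>i'<d. (cnj (w i) * w i') * (G k i * cnj (G k i'))) / of_nat l"
    unfolding sum_product by (intro arg_cong2[of _ _ _ _ "(/)"] sum.cong refl) (simp only: mult_ac)
  also have "\<dots> = (\<Sum>i<d. \<Sum>i'<d. \<Sum>k<l. (cnj (w i) * w i') * (G k i * cnj (G k i'))) / of_nat l"
    by (subst sum.swap) (intro arg_cong2[of _ _ _ _ "(/)"] sum.cong refl sum.swap)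
  also have "\<dots> = (\<Sum>i<d. \<Sum>i'<d. (cnj (w i) * w i') * ((\<Sum>k<l. G k i * cnj (G k i')) / of_nat l))"
    by (simp add: sum_distrib_left sum_divide_distrib)
  also have "\<dots> = (\<Sum>i<d. \<Sum>i'<d. (cnj (w i) * w i') * D i i' + (if i = i' then b * (cnj (w i) * w i') else 0))"
    by (intro sum.cong refl) (simp add: D_def algebra_simps)
  also have "\<dots> = (\<Sum>i<d. \<Sum>i'<d. (cnj (w i) * w i') * D i i') + b * of_real (\<Sum>i<d. (cmod (w i))\<^sup>2)"
    by (simp add: sum.distrib sum.delta' sum_distrib_left complex_norm_square mult.commute del: of_real_power)
  finally have eq: "complex_of_real ((\<Sum>k<l. (cmod (\<Sum>i<d. cnj (w i) * G k i))\<^sup>2) / l) = \<dots>" .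
  have "(\<Sum>k<l. (cmod (\<Sum>i<d. cnj (w i) * G k i))\<^sup>2) / l
      = cmod (complex_of_real ((\<Sum>k<l. (cmod (\<Sum>i<d. cnj (w i) * G k i))\<^sup>2) / l))"
    by (simp only: norm_of_real) (simp add: sum_nonneg)
  also have "\<dots> \<le> cmod (\<Sum>i<d. \<Sum>i'<d. (cnj (w i) * w i') * D i i') + cmod b * (\<Sum>i<d. (cmod (w i))\<^sup>2)"
    unfolding eq by (rule norm_triangle_le) (simp only: norm_mult norm_of_real, simp add: sum_nonneg)
  also have "cmod (\<Sum>i<d. \<Sum>i'<d. (cnj (w i) * w i') * D i i') \<le> (\<Sum>i<d. \<Sum>i'<d. (cmod (w i) * cmod (w i')) * \<delta>)"
  proof (intro order_trans[OF norm_sum] sum_mono)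
    fix i i' assume "i \<in> {..<d}" "i' \<in> {..<d}"
    then have "cmod (D i i') \<le> \<delta>" unfolding D_def by (intro gram) auto
    then show "cmod ((cnj (w i) * w i') * D i i') \<le> (cmod (w i) * cmod (w i')) * \<delta>"
      by (simp add: norm_mult mult_left_mono)
  qed
  also have "\<dots> = \<delta> * (\<Sum>i<d. cmod (w i))\<^sup>2"
    unfolding power2_eq_square sum_product
    by (simp only: sum_distrib_left mult.commute)
  also have "\<dots> \<le> \<delta> * (real d * (\<Sum>i<d. (cmod (w i))\<^sup>2))"
  proof (rule mult_left_mono[OF _ \<open>\<delta> \<ge> 0\<close>])
    show "(\<Sum>i<d. cmod (w i))\<^sup>2 \<le> real d * (\<Sum>i<d. (cmod (w i))\<^sup>2)"
      using Cauchy_Schwarz_ineq_sum[of "\<lambda>_. 1" "\<lambda>i. cmod (w i)" "{..<d}"] by simp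
  qed
  finally show ?thesis by (simp add: distrib_right mult_ac)
qed

text \<open>For \<open>z = r cis \<theta>\<close> the two points are the ends of the chord through \<open>z\<close> perpendicular to its radius.\<close>

lemma disc_is_midpoint_of_circle:
  assumes "cmod z \<le> 1"
  shows "\<exists>w :: bool \<Rightarrow> complex. (\<forall>b. cmod (w b) = 1) \<and> w False + w True = 2 * z"
proof -
  define r s where "r = cmod z" and "s = sqrt (1 - r\<^sup>2)"
  have "r\<^sup>2 \<le> 1" using assms by (simp add: r_def power_le_one)
  then have rs: "sqrt (r\<^sup>2 + s\<^sup>2) = 1" by (simp add: s_def)
  define w where "w = (\<lambda>b. cis (Arg z) * Complex r (if b then s else - s))"
  have "cmod (w b) = 1" for b
    using rs by (simp add: w_def norm_mult complex_norm)
  moreover have "w False + w True = cis (Arg z) * (2 * r)"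
    by (simp add: w_def complex_eq_iff flip: distrib_left)
  moreover have "z = r * cis (Arg z)"
    using rcis_cmod_Arg[of z] by (simp add: rcis_def r_def)
  ultimately show ?thesis by (intro exI[of _ w]) (simp add: mult_ac)
qed

text \<open>The hypothesis bounds the adjoint of \<open>C\<close>, which has the same norm: apply it to \<open>w = C v\<close> and use
Cauchy-Schwarz in \<open>|C v|^2 = \<langle>C* w, v\<rangle>\<close>.\<close>

lemma op_norm_le:
  assumes C: "C \<in> carrier_mat m l" and "K \<ge> 0"
    and adj: "\<And>w :: nat \<Rightarrow> complex. (\<Sum>q<l. (cmod (\<Sum>i<m. cnj (w i) * C $$ (i, q)))\<^sup>2)
                \<le> K\<^sup>2 * (\<Sum>i<m. (cmod (w i))\<^sup>2)"
  shows "op_norm C \<le> K"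
  unfolding op_norm_def
proof (rule cSup_least)
  have "euclid_norm (0\<^sub>v l) \<le> 1" by (simp add: euclid_norm_def L2_set_def)
  then show "{euclid_norm (C *\<^sub>v v) |v. v \<in> carrier_vec (dim_col C) \<and> euclid_norm v \<le> 1} \<noteq> {}"
    using C by (auto intro!: exI[of _ "0\<^sub>v l"])
next
  fix r assume "r \<in> {euclid_norm (C *\<^sub>v v) |v. v \<in> carrier_vec (dim_col C) \<and> euclid_norm v \<le> 1}"
  then obtain v where v: "v \<in> carrier_vec l" "euclid_norm v \<le> 1" and r: "r = euclid_norm (C *\<^sub>v v)"
    using C by auto
  define w where "w = (\<lambda>i. \<Sum>q<l. C $$ (i, q) * (v $ q))"
  have "(C *\<^sub>v v) $ i = w i" if "i < m" for i
    using that C v by (simp add: w_def scalar_prod_def lessThan_atLeast0)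
  then have r_L2: "r = L2_set (\<lambda>i. cmod (w i)) {..<m}"
    unfolding r euclid_norm_def using C by (intro L2_set_cong) auto
  then have r2: "r\<^sup>2 = (\<Sum>i<m. (cmod (w i))\<^sup>2)" and "r \<ge> 0"
    by (simp_all add: L2_set_def sum_nonneg)
  define y where "y = (\<lambda>q. \<Sum>i<m. cnj (w i) * C $$ (i, q))"
  have "complex_of_real (r\<^sup>2) = (\<Sum>i<m. cnj (w i) * w i)"
    unfolding r2 by (simp add: complex_norm_square mult.commute del: of_real_power)
  also have "\<dots> = (\<Sum>i<m. \<Sum>q<l. cnj (w i) * C $$ (i, q) * (v $ q))"
    by (simp add: w_def sum_distrib_left mult.assoc)
  also have "\<dots> = (\<Sum>q<l. y q * (v $ q))"
    by (subst sum.swap) (simp add: y_def sum_distrib_right)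
  finally have "r\<^sup>2 = cmod (\<Sum>q<l. y q * (v $ q))"
    by (metis norm_of_real abs_power2)
  also have "\<dots> \<le> (\<Sum>q<l. \<bar>cmod (y q)\<bar> * \<bar>cmod (v $ q)\<bar>)"
    by (rule order_trans[OF norm_sum]) (simp add: norm_mult)
  also have "\<dots> \<le> L2_set (\<lambda>q. cmod (y q)) {..<l} * L2_set (\<lambda>q. cmod (v $ q)) {..<l}"
    by (rule L2_set_mult_ineq)
  also have "\<dots> \<le> L2_set (\<lambda>q. cmod (y q)) {..<l} * 1"
    using v by (intro mult_left_mono) (auto simp: euclid_norm_def)
  also have "\<dots> \<le> sqrt (K\<^sup>2 * r\<^sup>2)"
    unfolding L2_set_def using adj[of w] by (simp add: y_def r2)
  also have "\<dots> = K * r" using \<open>K \<ge> 0\<close> \<open>r \<ge> 0\<close> by (simp add: real_sqrt_mult)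
  finally show "r \<le> K" using \<open>r \<ge> 0\<close> \<open>K \<ge> 0\<close>
    by (cases "r = 0") (simp_all add: power2_eq_square)
qed

text \<open>Passage from families to matrices. An arbitrary finite index set \<open>Q\<close> lets sample columns and
correction columns carry their natural indices.\<close>

lemma factorization_from_family:
  fixes c z :: "'q \<Rightarrow> nat \<Rightarrow> complex"
  assumes "finite Q" "Q \<noteq> {}" and X: "X \<in> carrier_mat m n" and "K \<ge> 0"
    and unimodular: "\<And>q j. q \<in> Q \<Longrightarrow> j < n \<Longrightarrow> cmod (z q j) = 1"
    and entries: "\<And>i j. i < m \<Longrightarrow> j < n \<Longrightarrow> (\<Sum>q\<in>Q. c q i * z q j) = sqrt (card Q) * X $$ (i, j)"
    and adj: "\<And>w :: nat \<Rightarrow> complex. (\<Sum>q\<in>Q. (cmod (\<Sum>i<m. cnj (w i) * c q i))\<^sup>2)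
                \<le> K\<^sup>2 * (\<Sum>i<m. (cmod (w i))\<^sup>2)"
  shows "\<exists>(l::nat) C Z. l \<ge> 1 \<and> C \<in> carrier_mat m l \<and> op_norm C \<le> K \<and> Z \<in> unimodular_mat l n
           \<and> X = complex_of_real (real l powr (- 1 / 2)) \<cdot>\<^sub>m (C * Z)"
proof -
  define l where "l = card Q"
  have "l \<ge> 1" using assms(1,2) by (simp add: l_def Suc_le_eq card_gt_0_iff)
  obtain e where e: "bij_betw e {..<l} Q"
    using ex_bij_betw_nat_finite[OF \<open>finite Q\<close>] by (auto simp: l_def lessThan_atLeast0)
  have sum_e: "(\<Sum>q<l. F (e q)) = (\<Sum>q\<in>Q. F q)" for F :: "'q \<Rightarrow> 'b::comm_monoid_add"
    using sum.reindex_bij_betw[OF e] .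
  define C where "C = mat m l (\<lambda>(i, q). c (e q) i)"
  define Z where "Z = mat l n (\<lambda>(q, j). z (e q) j)"
  have C: "C \<in> carrier_mat m l" by (simp add: C_def)
  have "op_norm C \<le> K"
  proof (rule op_norm_le[OF C \<open>K \<ge> 0\<close>])
    fix w :: "nat \<Rightarrow> complex"
    show "(\<Sum>q<l. (cmod (\<Sum>i<m. cnj (w i) * C $$ (i, q)))\<^sup>2) \<le> K\<^sup>2 * (\<Sum>i<m. (cmod (w i))\<^sup>2)"
      using adj[of w] sum_e[of "\<lambda>q. (cmod (\<Sum>i<m. cnj (w i) * c q i))\<^sup>2"] by (simp add: C_def)
  qed
  moreover have "Z \<in> unimodular_mat l n"
    using unimodular bij_betwE[OF e] by (auto simp: unimodular_mat_def Z_def)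
  moreover have "X = complex_of_real (real l powr (- 1 / 2)) \<cdot>\<^sub>m (C * Z)"
  proof (rule eq_matI)
    fix i j assume "i < dim_row (complex_of_real (real l powr (- 1 / 2)) \<cdot>\<^sub>m (C * Z))"
      "j < dim_col (complex_of_real (real l powr (- 1 / 2)) \<cdot>\<^sub>m (C * Z))"
    then have ij: "i < m" "j < n" by (simp_all add: C_def Z_def)
    have "(C * Z) $$ (i, j) = (\<Sum>q<l. c (e q) i * z (e q) j)"
      using ij by (simp add: C_def Z_def scalar_prod_def lessThan_atLeast0)
    also have "\<dots> = sqrt l * X $$ (i, j)"
      using sum_e[of "\<lambda>q. c q i * z q j"] entries[OF ij] by (simp add: l_def)
    finally have CZ: "(C * Z) $$ (i, j) = sqrt l * X $$ (i, j)" .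
    have "real l powr (- 1 / 2) * sqrt l = 1"
      using \<open>l \<ge> 1\<close> by (simp add: powr_half_sqrt[symmetric] powr_minus flip: powr_add)
    then have "complex_of_real (real l powr (- 1 / 2)) * complex_of_real (sqrt l) = 1"
      by (metis of_real_mult of_real_1)
    then show "X $$ (i, j) = (complex_of_real (real l powr (- 1 / 2)) \<cdot>\<^sub>m (C * Z)) $$ (i, j)"
      using ij CZ by (simp add: C_def Z_def flip: mult.assoc)
  qed (use X in \<open>simp_all add: C_def Z_def\<close>)
  ultimately show ?thesis using \<open>l \<ge> 1\<close> C by blast
qed

text \<open>Each of the \<open>l\<close> samples is repeated \<open>N\<close> times and accompanied by \<open>2 m\<close> correction columns, two for
each coordinate vector, which supply the error matrix \<open>E\<close> through its midpoint representation.
The number of columns is then \<open>l (N + 2 m)\<close>: the normalization inflates the contribution of the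
samples to \<open>C C*\<close> by \<open>1 + 2 m / N\<close>, and that of the correction columns is
\<open>(N + 2 m) \<delta>^2 / 2\<close>. Neither depends on \<open>l\<close>, so \<open>N\<close> and then \<open>\<delta>\<close> can be fixed before sampling;
a fixed number of correction columns would instead need \<open>\<delta>\<close> of smaller order than \<open>1 / sqrt l\<close>, which
sampling does not give.\<close>

lemma exact_factorization_from_samples:
  fixes G z :: "nat \<Rightarrow> nat \<Rightarrow> complex" and l N m n :: nat
  assumes "l \<ge> 1" "N \<ge> 1" "\<delta> > 0" "K \<ge> 0" and X: "X \<in> carrier_mat m n"
    and unimodular: "\<And>k j. cmod (z k j) = 1"
    and approx: "\<And>i j. i < m \<Longrightarrow> j < n \<Longrightarrow>
        cmod (X $$ (i, j) - (\<Sum>k<l. z k j * G k i) / of_nat l) \<le> \<delta>"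
    and gram: "\<And>w :: nat \<Rightarrow> complex. (\<Sum>k<l. (cmod (\<Sum>i<m. cnj (w i) * G k i))\<^sup>2) / l
        \<le> B * (\<Sum>i<m. (cmod (w i))\<^sup>2)"
    and K: "(1 + 2 * real m / N) * B + (N + 2 * real m) * \<delta>\<^sup>2 / 2 \<le> K\<^sup>2"
  shows "\<exists>(l::nat) C Z. l \<ge> 1 \<and> C \<in> carrier_mat m l \<and> op_norm C \<le> K \<and> Z \<in> unimodular_mat l n
           \<and> X = complex_of_real (real l powr (- 1 / 2)) \<cdot>\<^sub>m (C * Z)"
proof -
  define E where "E = (\<lambda>i j. X $$ (i, j) - (\<Sum>k<l. z k j * G k i) / of_nat l)"
  have "\<exists>w :: bool \<Rightarrow> complex. (\<forall>b. cmod (w b) = 1) \<and> w False + w True = 2 * (E i j / \<delta>)"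
    if "i < m" "j < n" for i j
    using approx[OF that] \<open>\<delta> > 0\<close>
    by (intro disc_is_midpoint_of_circle) (simp add: E_def norm_divide)
  then obtain W :: "nat \<Rightarrow> nat \<Rightarrow> bool \<Rightarrow> complex"
    where W1: "\<And>i j b. i < m \<Longrightarrow> j < n \<Longrightarrow> cmod (W i j b) = 1"
      and W2: "\<And>i j. i < m \<Longrightarrow> j < n \<Longrightarrow> W i j False + W i j True = 2 * (E i j / \<delta>)"
    by metis
  define S where "S = {..<N} <+> ({..<m} \<times> (UNIV :: bool set))"
  define Q where "Q = {..<l} \<times> S"
  define L where "L = real l * (real N + 2 * real m)"
  have fin: "finite S" "finite Q" by (simp_all add: S_def Q_def)
  have "Q \<noteq> {}" using \<open>l \<ge> 1\<close> \<open>N \<ge> 1\<close> by (auto simp: Q_def S_def lessThan_empty_iff)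
  have card_Q: "real (card Q) = L"
    by (simp add: Q_def S_def L_def card_Plus card_cartesian_product algebra_simps)
  have "L > 0" using \<open>l \<ge> 1\<close> \<open>N \<ge> 1\<close> by (simp add: L_def)
  have sum_Q: "(\<Sum>q\<in>Q. F q) = (\<Sum>k<l. (\<Sum>s<N. F (k, Inl s)) + (\<Sum>i<m. F (k, Inr (i, False)) + F (k, Inr (i, True))))"
    for F :: "_ \<Rightarrow> 'b::comm_monoid_add"
    unfolding Q_def S_def
    by (simp only: sum.cartesian_product' sum.Plus finite_lessThan finite_cartesian_product finite o_def)
      (simp add: UNIV_bool add.commute)
  define c where "c = (\<lambda>(k, s). case s of
      Inl (_ :: nat) \<Rightarrow> (\<lambda>i. (sqrt L / (l * N)) * G k i)
    | Inr (i', b :: bool) \<Rightarrow> (\<lambda>i. if i = i' then complex_of_real (sqrt L * \<delta> / (2 * l)) else 0))"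
  define \<zeta> where "\<zeta> = (\<lambda>(k, s). case s of Inl (_ :: nat) \<Rightarrow> z k | Inr (i', b) \<Rightarrow> (\<lambda>j. W i' j b))"
  show ?thesis
  proof (rule factorization_from_family[OF fin(2) \<open>Q \<noteq> {}\<close> X \<open>K \<ge> 0\<close>])
    show "cmod (\<zeta> q j) = 1" if "q \<in> Q" "j < n" for q j
      using that unimodular W1 by (auto simp: Q_def S_def \<zeta>_def)
  next
    fix i j assume ij: "i < m" "j < n"
    have "(\<Sum>q\<in>Q. c q i * \<zeta> q j) = (\<Sum>k<l. (sqrt L / l) * (z k j * G k i) + (sqrt L / l) * E i j)"
    proof (subst sum_Q, rule sum.cong[OF refl])
      fix k
      have "(\<Sum>s<N. c (k, Inl s) i * \<zeta> (k, Inl s) j) = (sqrt L / l) * (z k j * G k i)"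
        using \<open>N \<ge> 1\<close> by (simp add: c_def \<zeta>_def)
      moreover have "(\<Sum>i'<m. c (k, Inr (i', False)) i * \<zeta> (k, Inr (i', False)) j
            + c (k, Inr (i', True)) i * \<zeta> (k, Inr (i', True)) j)
          = (\<Sum>i'<m. if i' = i then complex_of_real (sqrt L * \<delta> / (2 * l)) * (W i j False + W i j True) else 0)"
        by (intro sum.cong refl) (auto simp: c_def \<zeta>_def algebra_simps add_divide_distrib)
      moreover have "\<dots> = (sqrt L / l) * E i j"
        using ij \<open>\<delta> > 0\<close> by (simp add: W2)
      ultimately show "(\<Sum>s<N. c (k, Inl s) i * \<zeta> (k, Inl s) j)
          + (\<Sum>i'<m. c (k, Inr (i', False)) i * \<zeta> (k, Inr (i', False)) j
            + c (k, Inr (i', True)) i * \<zeta> (k, Inr (i', True)) j)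
          = (sqrt L / l) * (z k j * G k i) + (sqrt L / l) * E i j" by simp
    qed
    also have "\<dots> = sqrt L * ((\<Sum>k<l. z k j * G k i) / of_nat l + E i j)"
      using \<open>l \<ge> 1\<close> by (simp add: sum.distrib distrib_left flip: sum_distrib_left sum_divide_distrib)
    also have "\<dots> = sqrt (card Q) * X $$ (i, j)" by (simp add: E_def card_Q)
    finally show "(\<Sum>q\<in>Q. c q i * \<zeta> q j) = sqrt (card Q) * X $$ (i, j)" .
  next
    fix w :: "nat \<Rightarrow> complex"
    define A where "A = (\<lambda>k. (cmod (\<Sum>i<m. cnj (w i) * G k i))\<^sup>2)"
    define w2 where "w2 = (\<Sum>i<m. (cmod (w i))\<^sup>2)"
    have "(\<Sum>q\<in>Q. (cmod (\<Sum>i<m. cnj (w i) * c q i))\<^sup>2)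
        = (\<Sum>k<l. N * ((sqrt L / (l * N))\<^sup>2 * A k) + 2 * (sqrt L * \<delta> / (2 * l))\<^sup>2 * w2)"
    proof (subst sum_Q, rule sum.cong[OF refl])
      fix k
      have "(\<Sum>i<m. cnj (w i) * c (k, Inl s) i) = (sqrt L / (l * N)) * (\<Sum>i<m. cnj (w i) * G k i)" for s
        by (simp add: c_def sum_distrib_left mult_ac)
      then have a: "(cmod (\<Sum>i<m. cnj (w i) * c (k, Inl s) i))\<^sup>2 = (sqrt L / (l * N))\<^sup>2 * A k" for s
        by (simp only: norm_mult A_def power_mult_distrib norm_of_real power2_abs)
      have "(\<Sum>i<m. cnj (w i) * c (k, Inr (i', b)) i) = complex_of_real (sqrt L * \<delta> / (2 * l)) * cnj (w i')"
        if "i' < m" for i' b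
        using that by (simp add: c_def if_distrib[of "\<lambda>x. _ * x"] cong: if_cong)
      then have b: "(cmod (\<Sum>i<m. cnj (w i) * c (k, Inr (i', b)) i))\<^sup>2 = (sqrt L * \<delta> / (2 * l))\<^sup>2 * (cmod (w i'))\<^sup>2"
        if "i' < m" for i' b
        using that by (simp only: norm_mult power_mult_distrib norm_of_real power2_abs complex_mod_cnj)
      show "(\<Sum>s<N. (cmod (\<Sum>i<m. cnj (w i) * c (k, Inl s) i))\<^sup>2)
          + (\<Sum>i'<m. (cmod (\<Sum>i<m. cnj (w i) * c (k, Inr (i', False)) i))\<^sup>2
              + (cmod (\<Sum>i<m. cnj (w i) * c (k, Inr (i', True)) i))\<^sup>2)
          = N * ((sqrt L / (l * N))\<^sup>2 * A k) + 2 * (sqrt L * \<delta> / (2 * l))\<^sup>2 * w2"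
        by (simp add: a b w2_def sum_distrib_left mult.assoc flip: mult_2)
    qed
    also have "\<dots> = (L / (l * N)) * ((\<Sum>k<l. A k) / l) + L * \<delta>\<^sup>2 / (2 * l) * w2"
    proof -
      have "N * ((sqrt L / (l * N))\<^sup>2 * A k) = (L / (l * N)) * (A k / l)" for k
        using \<open>L > 0\<close> \<open>N \<ge> 1\<close> by (simp add: power_divide power_mult_distrib power2_eq_square)
      moreover have "2 * (sqrt L * \<delta> / (2 * l))\<^sup>2 = L * \<delta>\<^sup>2 / (2 * l) / l"
        using \<open>L > 0\<close> by (simp add: power_divide power_mult_distrib power2_eq_square mult_ac)
      ultimately show ?thesis
        using \<open>l \<ge> 1\<close> by (simp add: sum.distrib flip: sum_distrib_left sum_divide_distrib)
    qed
    also have "\<dots> \<le> (L / (l * N)) * (B * w2) + L * \<delta>\<^sup>2 / (2 * l) * w2"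
      using gram[of w] \<open>L > 0\<close> by (intro add_right_mono mult_left_mono) (auto simp: A_def w2_def)
    also have "\<dots> = ((1 + 2 * real m / N) * B + (N + 2 * real m) * \<delta>\<^sup>2 / 2) * w2"
      using \<open>l \<ge> 1\<close> \<open>N \<ge> 1\<close> by (simp add: L_def field_simps)
    also have "\<dots> \<le> K\<^sup>2 * w2"
      using K by (intro mult_right_mono) (auto simp: w2_def sum_nonneg)
    finally show "(\<Sum>q\<in>Q. (cmod (\<Sum>i<m. cnj (w i) * c q i))\<^sup>2) \<le> K\<^sup>2 * (\<Sum>i<m. (cmod (w i))\<^sup>2)"
      by (simp add: w2_def)
  qed
qed

theorem theorem2p4:
  fixes m n :: nat and X :: "complex mat" and \<epsilon> :: real
  assumes "m \<ge> 1" and "n \<ge> 1"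
    and "X \<in> carrier_mat m n"
    and "column_norm X \<le> 1"
    and "0 < \<epsilon>" and "\<epsilon> < 1"
  shows "\<exists>(l::nat) C Z. l \<ge> 1
           \<and> C \<in> carrier_mat m l \<and> op_norm C < sqrt kGC * (1 + \<epsilon>)
           \<and> Z \<in> unimodular_mat l n
           \<and> X = complex_of_real (real l powr (- 1 / 2)) \<cdot>\<^sub>m (C * Z)"
proof -
  note X = \<open>X \<in> carrier_mat m n\<close>
  have col_le: "(\<Sum>i<m. (cmod (X $$ (i, j)))\<^sup>2) \<le> 1" if "j < n" for j
  proof -
    have "euclid_norm (col X j) \<le> column_norm X"
      unfolding column_norm_def using X that by (intro Max_ge) auto
    then have "euclid_norm (col X j) \<le> 1" using \<open>column_norm X \<le> 1\<close> by simp
    then have "sqrt (\<Sum>i<m. (cmod (X $$ (i, j)))\<^sup>2) \<le> 1"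
      using X that by (simp add: euclid_norm_def L2_set_def)
    then show ?thesis by simp
  qed
  \<comment> \<open>The extra coordinate with index \<open>m\<close> completes each column to a unit vector.\<close>
  define x where "x = (\<lambda>j i. if i < m then X $$ (i, j)
      else complex_of_real (sqrt (1 - (\<Sum>i<m. (cmod (X $$ (i, j)))\<^sup>2))))"
  have unit: "(\<Sum>i<Suc m. (cmod (x j i))\<^sup>2) = 1" if "j \<in> {..<n}" for j
    using col_le[of j] that by (simp add: x_def)

  \<comment> \<open>These choices make the two contributions to the squared norm at most
     \<open>(1 + \<epsilon> / 2) (1 + \<epsilon> / 8)\<close> and \<open>\<epsilon> / 8\<close> times \<open>4 / pi\<close>; the sum stays below \<open>4 / pi (1 + \<epsilon>)^2\<close>.\<close>
  obtain N :: nat where N: "4 * m / \<epsilon> \<le> N" "N \<ge> 1"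
    by (metis real_arch_simple le_max_iff_disj max.cobounded2 max.cobounded1 of_nat_le_iff order_trans)
  define \<delta> where "\<delta> = \<epsilon> / (2 * (N + 2 * real m))"
  have "\<delta> > 0" using \<open>\<epsilon> > 0\<close> N(2) by (simp add: \<delta>_def)
  obtain M :: "(nat \<times> bool \<Rightarrow> real) measure" and u where "gaussian_vector M (Suc m) u"
    using exists_gaussian_vector[of "Suc m"] by auto
  then interpret gaussian_vector M "Suc m" u .
  obtain l and G z :: "nat \<Rightarrow> nat \<Rightarrow> complex" where "l \<ge> 1"
    and z: "\<forall>k j. cmod (z k j) = 1"
    and approx: "\<forall>j\<in>{..<n}. \<forall>i<Suc m.
        cmod ((\<Sum>k<l. z k j * G k i) / of_nat l - sqrt (pi / 2) * x j i) \<le> \<delta>"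
    and gram: "\<forall>i<Suc m. \<forall>i'<Suc m.
        cmod ((\<Sum>k<l. G k i * cnj (G k i')) / of_nat l - (if i = i' then 2 else 0)) \<le> \<delta>"
    using exists_samples[of "{..<n}" x, OF finite_lessThan unit \<open>\<delta> > 0\<close>] by blast

  define \<kappa> where "\<kappa> = sqrt (2 / pi)"
  have \<kappa>: "0 < \<kappa>" "\<kappa> \<le> 1" "\<kappa>\<^sup>2 = 2 / pi" "\<kappa> * sqrt (pi / 2) = 1"
    using pi_gt3 by (auto simp: \<kappa>_def simp flip: real_sqrt_mult)
  define B where "B = 2 / pi * (2 + m * \<delta>)"
  define K where "K = sqrt ((1 + 2 * real m / N) * B + (N + 2 * real m) * \<delta>\<^sup>2 / 2)"
  have "B \<ge> 0" using \<open>\<delta> > 0\<close> by (simp add: B_def)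
  then have radicand: "0 \<le> (1 + 2 * real m / N) * B + (N + 2 * real m) * \<delta>\<^sup>2 / 2" by simp

  have "\<exists>(l::nat) C Z. l \<ge> 1 \<and> C \<in> carrier_mat m l \<and> op_norm C \<le> K \<and> Z \<in> unimodular_mat l n
           \<and> X = complex_of_real (real l powr (- 1 / 2)) \<cdot>\<^sub>m (C * Z)"
  proof (rule exact_factorization_from_samples[where l = l and N = N and G = "\<lambda>k i. \<kappa> * G k i" and z = z and B = B])
    fix i j assume ij: "i < m" "j < n"
    have "X $$ (i, j) - (\<Sum>k<l. z k j * (\<kappa> * G k i)) / of_nat l
        = - (\<kappa> * ((\<Sum>k<l. z k j * G k i) / of_nat l - sqrt (pi / 2) * x j i))"
    proof -
      have "\<kappa> * (complex_of_real (sqrt (pi / 2)) * x j i) = X $$ (i, j)"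
        using \<kappa>(4) ij by (simp add: x_def flip: mult.assoc of_real_mult)
      then show ?thesis by (simp add: right_diff_distrib sum_distrib_left mult_ac)
    qed
    then have "cmod (X $$ (i, j) - (\<Sum>k<l. z k j * (\<kappa> * G k i)) / of_nat l)
        = \<kappa> * cmod ((\<Sum>k<l. z k j * G k i) / of_nat l - sqrt (pi / 2) * x j i)"
      using \<kappa>(1) by (simp add: norm_mult)
    also have "\<dots> \<le> 1 * \<delta>"
      using \<kappa> approx ij \<open>\<delta> > 0\<close> by (intro mult_mono) auto
    finally show "cmod (X $$ (i, j) - (\<Sum>k<l. z k j * (\<kappa> * G k i)) / of_nat l) \<le> \<delta>" by simp
  next
    fix w :: "nat \<Rightarrow> complex"
    have "(\<Sum>k<l. (cmod (\<Sum>i<m. cnj (w i) * (\<kappa> * G k i)))\<^sup>2) / l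
        = \<kappa>\<^sup>2 * ((\<Sum>k<l. (cmod (\<Sum>i<m. cnj (w i) * G k i))\<^sup>2) / l)"
    proof -
      have "(\<Sum>i<m. cnj (w i) * (\<kappa> * G k i)) = \<kappa> * (\<Sum>i<m. cnj (w i) * G k i)" for k
        by (simp add: sum_distrib_left mult_ac)
      then have "(cmod (\<Sum>i<m. cnj (w i) * (\<kappa> * G k i)))\<^sup>2
          = \<kappa>\<^sup>2 * (cmod (\<Sum>i<m. cnj (w i) * G k i))\<^sup>2" for k
        by (simp only: norm_mult power_mult_distrib norm_of_real power2_abs)
      then show ?thesis by (simp only: sum_distrib_left times_divide_eq_right)
    qed
    also have "\<dots> \<le> \<kappa>\<^sup>2 * ((cmod 2 + m * \<delta>) * (\<Sum>i<m. (cmod (w i))\<^sup>2))"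
    proof (rule mult_left_mono[OF quadratic_form_bound[OF \<open>l \<ge> 1\<close>]])
      show "cmod ((\<Sum>k<l. G k i * cnj (G k i')) / of_nat l - (if i = i' then 2 else 0)) \<le> \<delta>"
        if "i < m" "i' < m" for i i'
        using gram that less_SucI by blast
    qed (use \<open>\<delta> > 0\<close> in simp_all)
    also have "\<dots> = B * (\<Sum>i<m. (cmod (w i))\<^sup>2)" by (simp add: B_def \<kappa>(3))
    finally show "(\<Sum>k<l. (cmod (\<Sum>i<m. cnj (w i) * (\<kappa> * G k i)))\<^sup>2) / l \<le> B * (\<Sum>i<m. (cmod (w i))\<^sup>2)" .
  qed (use \<open>l \<ge> 1\<close> N \<open>\<delta> > 0\<close> X z radicand in \<open>simp_all add: K_def\<close>)
  moreover have "K < sqrt kGC * (1 + \<epsilon>)"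
  proof -
    have small: "2 * real m / N \<le> \<epsilon> / 2" using N \<open>\<epsilon> > 0\<close> by (simp add: field_simps)
    have N\<delta>: "(N + 2 * real m) * \<delta> = \<epsilon> / 2" using N(2) by (simp add: \<delta>_def field_simps)
    have "2 * (real m * \<delta>) \<le> (N + 2 * real m) * \<delta>" using \<open>\<delta> > 0\<close> by (simp add: algebra_simps)
    then have m\<delta>: "m * \<delta> \<le> \<epsilon> / 4" using N\<delta> by simp
    have "1 * \<delta> \<le> (N + 2 * real m) * \<delta>" using N(2) \<open>\<delta> > 0\<close> by (intro mult_right_mono) auto
    then have "\<delta> \<le> \<epsilon> / 2" using N\<delta> by simp
    have "B \<le> 4 / pi * (1 + \<epsilon> / 8)"
      using m\<delta> by (simp add: B_def field_simps)
    then have "(1 + 2 * real m / N) * B \<le> (1 + \<epsilon> / 2) * (4 / pi * (1 + \<epsilon> / 8))"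
      using small \<open>B \<ge> 0\<close> \<open>\<epsilon> > 0\<close> by (intro mult_mono) auto
    moreover have "(N + 2 * real m) * \<delta>\<^sup>2 / 2 \<le> 4 / pi * (\<epsilon> / 8)"
    proof -
      have "(N + 2 * real m) * \<delta>\<^sup>2 / 2 = ((N + 2 * real m) * \<delta>) * \<delta> / 2"
        by (simp add: power2_eq_square)
      also have "\<dots> = \<epsilon> / 4 * \<delta>" unfolding N\<delta> by simp
      also have "\<dots> \<le> \<epsilon> / 4 * (1 / 2)" using \<open>\<delta> \<le> \<epsilon> / 2\<close> \<open>\<epsilon> > 0\<close> \<open>\<epsilon> < 1\<close> by (intro mult_left_mono) auto
      also have "\<dots> \<le> 4 / pi * (\<epsilon> / 8)"
        using pi_less_4 \<open>\<epsilon> > 0\<close> by (simp add: field_simps)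
      finally show ?thesis .
    qed
    moreover have "(1 + \<epsilon> / 2) * (4 / pi * (1 + \<epsilon> / 8)) + 4 / pi * (\<epsilon> / 8) < 4 / pi * (1 + \<epsilon>)\<^sup>2"
    proof -
      have "(1 + \<epsilon> / 2) * (1 + \<epsilon> / 8) + \<epsilon> / 8 < (1 + \<epsilon>)\<^sup>2"
      proof -
        have "(1 + \<epsilon>)\<^sup>2 - ((1 + \<epsilon> / 2) * (1 + \<epsilon> / 8) + \<epsilon> / 8) = 5 / 4 * \<epsilon> + 15 / 16 * (\<epsilon> * \<epsilon>)"
          by (simp add: power2_eq_square field_simps)
        moreover have "0 < \<epsilon> * \<epsilon>" using \<open>\<epsilon> > 0\<close> by simp
        ultimately show ?thesis using \<open>\<epsilon> > 0\<close> by linarith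
      qed
      then have "4 / pi * ((1 + \<epsilon> / 2) * (1 + \<epsilon> / 8) + \<epsilon> / 8) < 4 / pi * (1 + \<epsilon>)\<^sup>2"
        by (intro mult_strict_left_mono) auto
      moreover have factor: "a * (c * b) + c * e = c * (a * b + e)" for a b c e :: real
        by (simp add: algebra_simps)
      ultimately show ?thesis by (subst factor)
    qed
    ultimately have "K < sqrt (4 / pi * (1 + \<epsilon>)\<^sup>2)"
      unfolding K_def by (intro real_sqrt_less_mono) linarith
    also have "\<dots> = sqrt kGC * (1 + \<epsilon>)"
      using \<open>\<epsilon> > 0\<close> by (simp only: kGC_def real_sqrt_mult real_sqrt_abs)
    finally show ?thesis .
  qed
  ultimately obtain l' C Z where "l' \<ge> 1" "C \<in> carrier_mat m l'" "op_norm C < sqrt kGC * (1 + \<epsilon>)"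
      "Z \<in> unimodular_mat l' n" "X = complex_of_real (real l' powr (- 1 / 2)) \<cdot>\<^sub>m (C * Z)"
    using order.strict_trans1 by blast
  then show ?thesis by blast
qed

end
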